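(* Consider the simplified three-person game of baccara banque with parameter $\theta\in(0,1/2]$ (see context). For every $\theta\in\left(\frac{5772}{33847},\frac12\right]$ there exists a Nash equilibrium in which Players 1 and 2 independently draw on 5 with probabilities $p_1=p_2=\frac{9}{11}$, and in which Banker acts deterministically (always draws or always stands) at every information set other than $(10,10,6)$, $(10,11,6)$ and $(11,10,6)$, these three being information sets at which Banker is indifferent between drawing and standing.
   Context: Simplified game of baccara banque. Let $X_1,X_2,Y$ be i.i.d. on $\{0,\ldots,9\}$ with $P(\cdot=i)=q(i)=(16+9\delta_{i,0})/13^2$ (two-card totals of Player 1, Player 2, Banker), and let $X_1',X_2',Y'$ be i.i.d. on $\{0,\ldots,9\}$, independent of these, with $P(\cdot=k)=q'(k)=(1+3\delta_{k,0})/13$ (third-card values). $M(i)$ is the remainder of $i$ modulo $10$. Player $i$'s pure strategies are $u_i\in\{0,1\}$ ($0$ = stand on two-card total 5, $1$ = draw on 5); Player $i$ draws iff $X_i\le 4+u_i$. Put $K_i=X_i'$ if $X_i\le 4+u_i$, $K_i=10$ if $5+u_i\le X_i\le 7$ (stand), $K_i=11$ if $X_i\in\{8,9\}$ (natural); put $F_i=M(X_i+X_i')$ if $X_i\le 4+u_i$ and $F_i=X_i$ otherwise. Banker's information sets are the 1144 triples $(k_1,k_2,j)\in I:=[\{0,\ldots,11\}^2\setminus\{(11,11)\}]\times\{0,\ldots,7\}$; a Banker pure strategy is a subset $T\subset I$, the set on which he draws. If $Y\ge 8$ or both $X_1,X_2\ge 8$, set $G_i=\mathrm{sgn}(X_i-Y)$.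 Otherwise let $B=M(Y+Y')$ if $(K_1,K_2,Y)\in T$ and $B=Y$ if not, and set $G_i=1$ if $X_i\ge 8$ and $G_i=\mathrm{sgn}(F_i-B)$ if $X_i\le 7$. The payoffs are $\theta E[G_1]$ to Player 1, $(1-\theta)E[G_2]$ to Player 2, and $-E[\theta G_1+(1-\theta)G_2]$ to Banker (in units of total amount bet). A behavioral strategy of Banker is a map $\beta:I\to[0,1]$, $\beta(k_1,k_2,j)$ being the probability of drawing at $(k_1,k_2,j)$; since at most one information set is met per play, every mixed strategy over subsets $T$ is payoff-equivalent to the behavioral strategy of its marginal drawing probabilities. Player $i$'s mixed strategy is the probability $p_i\in[0,1]$ of drawing on 5, and the three participants randomize independently. A Nash equilibrium is a triple $(p_1,p_2,\beta)$ such that no one of the three participants can increase his own expected payoff by a unilateral change of strategy. *)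

theory Defs
  imports "HOL-Probability.Probability"
begin

section \<open>Cards\<close>

definition two_card_pmf :: "nat pmf" where
  "two_card_pmf = embed_pmf (\<lambda>i. if i \<le> 9 then (16 + 9 * of_bool (i = 0)) / 13 ^ 2 else 0)"

definition third_card_pmf :: "nat pmf" where
  "third_card_pmf = embed_pmf (\<lambda>k. if k \<le> 9 then (1 + 3 * of_bool (k = 0)) / 13 else 0)"

lemma pmf_two_card:
  "pmf two_card_pmf i = (if i \<le> 9 then (16 + 9 * of_bool (i = 0)) / 13 ^ 2 else 0)"
proof -
  let ?f = "\<lambda>i::nat. if i \<le> 9 then (16 + 9 * of_bool (i = 0)) / 13 ^ 2 else (0::real)"
  have "(\<integral>\<^sup>+ i. ennreal (?f i) \<partial>count_space UNIV) = (\<Sum>i\<in>{..9}. ennreal (?f i))"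
    by (rule nn_integral_count_space'[where A = "{..9}"]) auto
  also have "\<dots> = ennreal (\<Sum>i\<in>{..9}. ?f i)"
    by (rule sum_ennreal) auto
  also have "(\<Sum>i\<in>{..9}. ?f i) = 1"
    by (simp add: numeral_eq_Suc)
  finally show ?thesis
    unfolding two_card_pmf_def by (subst pmf_embed_pmf) auto
qed

lemma pmf_third_card:
  "pmf third_card_pmf k = (if k \<le> 9 then (1 + 3 * of_bool (k = 0)) / 13 else 0)"
proof -
  let ?f = "\<lambda>k::nat. if k \<le> 9 then (1 + 3 * of_bool (k = 0)) / 13 else (0::real)"
  have "(\<integral>\<^sup>+ k. ennreal (?f k) \<partial>count_space UNIV) = (\<Sum>k\<in>{..9}. ennreal (?f k))"
    by (rule nn_integral_count_space'[where A = "{..9}"]) auto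
  also have "\<dots> = ennreal (\<Sum>k\<in>{..9}. ?f k)"
    by (rule sum_ennreal) auto
  also have "(\<Sum>k\<in>{..9}. ?f k) = 1"
    by (simp add: numeral_eq_Suc)
  finally show ?thesis
    unfolding third_card_pmf_def by (subst pmf_embed_pmf) auto
qed

section \<open>The hands\<close>

definition M :: "nat \<Rightarrow> nat" where
  "M i = i mod 10"

text \<open>
  A player's pure strategy is a boolean: \<^const>\<open>True\<close> is drawing on 5 and \<^const>\<open>False\<close> is
  standing on 5.  The arguments \<open>x\<close>, \<open>x'\<close> are the two-card total and the third-card value.
\<close>

definition player_draws :: "bool \<Rightarrow> nat \<Rightarrow> bool" where
  "player_draws u x \<longleftrightarrow> x \<le> 4 + of_bool u"

definition K :: "bool \<Rightarrow> nat \<Rightarrow> nat \<Rightarrow> nat" where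
  "K u x x' = (if player_draws u x then x' else if x \<le> 7 then 10 else 11)"

definition F :: "bool \<Rightarrow> nat \<Rightarrow> nat \<Rightarrow> nat" where
  "F u x x' = (if player_draws u x then M (x + x') else x)"

text \<open>
  \<open>d\<close> is Banker's action (\<^const>\<open>True\<close> for drawing) at the information set that is met.
\<close>

definition B :: "bool \<Rightarrow> nat \<Rightarrow> nat \<Rightarrow> nat" where
  "B d y y' = (if d then M (y + y') else y)"

definition I :: "(nat \<times> nat \<times> nat) set" where
  "I = {(k1, k2, j). (k1, k2) \<in> {0..11} \<times> {0..11} - {(11, 11)} \<and> j \<in> {0..7}}"

section \<open>A play\<close>

text \<open>
  A play up to Banker's action is a tuple \<open>(u1, u2, x1, x2, y, x1', x2', y')\<close> of the two
  players' realised pure strategies, the two-card totals and the third-card values.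
\<close>

type_synonym play = "bool \<times> bool \<times> nat \<times> nat \<times> nat \<times> nat \<times> nat \<times> nat"

fun banker_acts :: "play \<Rightarrow> bool" where
  "banker_acts (u1, u2, x1, x2, y, x1', x2', y') \<longleftrightarrow> \<not> (y \<ge> 8 \<or> (x1 \<ge> 8 \<and> x2 \<ge> 8))"

fun info_set :: "play \<Rightarrow> nat \<times> nat \<times> nat" where
  "info_set (u1, u2, x1, x2, y, x1', x2', y') = (K u1 x1 x1', K u2 x2 x2', y)"

definition sgn_diff :: "nat \<Rightarrow> nat \<Rightarrow> real" where
  "sgn_diff a b = sgn (real a - real b)"

fun G1 :: "play \<Rightarrow> bool \<Rightarrow> real" where
  "G1 (u1, u2, x1, x2, y, x1', x2', y') d =
    (if y \<ge> 8 \<or> (x1 \<ge> 8 \<and> x2 \<ge> 8) then sgn_diff x1 y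
     else if x1 \<ge> 8 then 1
     else sgn_diff (F u1 x1 x1') (B d y y'))"

fun G2 :: "play \<Rightarrow> bool \<Rightarrow> real" where
  "G2 (u1, u2, x1, x2, y, x1', x2', y') d =
    (if y \<ge> 8 \<or> (x1 \<ge> 8 \<and> x2 \<ge> 8) then sgn_diff x2 y
     else if x2 \<ge> 8 then 1
     else sgn_diff (F u2 x2 x2') (B d y y'))"

definition play_pmf :: "real \<Rightarrow> real \<Rightarrow> play pmf" where
  "play_pmf p1 p2 =
    pair_pmf (bernoulli_pmf p1) (pair_pmf (bernoulli_pmf p2)
      (pair_pmf two_card_pmf (pair_pmf two_card_pmf (pair_pmf two_card_pmf
        (pair_pmf third_card_pmf (pair_pmf third_card_pmf third_card_pmf))))))"

text \<open>
  Banker's action is sampled in every play, but \<^const>\<open>G1\<close> and \<^const>\<open>G2\<close> ignore it unless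
  \<^const>\<open>banker_acts\<close> holds, in which case (almost surely) \<^const>\<open>info_set\<close> is in \<^const>\<open>I\<close>.
\<close>

definition outcome_pmf ::
    "real \<Rightarrow> real \<Rightarrow> (nat \<times> nat \<times> nat \<Rightarrow> real) \<Rightarrow> (play \<times> bool) pmf" where
  "outcome_pmf p1 p2 \<beta> =
    bind_pmf (play_pmf p1 p2)
      (\<lambda>w. map_pmf (\<lambda>d. (w, d)) (bernoulli_pmf (\<beta> (info_set w))))"

section \<open>Payoffs and equilibrium\<close>

definition payoff1 ::
    "real \<Rightarrow> real \<Rightarrow> real \<Rightarrow> (nat \<times> nat \<times> nat \<Rightarrow> real) \<Rightarrow> real" where
  "payoff1 \<theta> p1 p2 \<beta> =
    \<theta> * measure_pmf.expectation (outcome_pmf p1 p2 \<beta>) (\<lambda>(w, d). G1 w d)"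

definition payoff2 ::
    "real \<Rightarrow> real \<Rightarrow> real \<Rightarrow> (nat \<times> nat \<times> nat \<Rightarrow> real) \<Rightarrow> real" where
  "payoff2 \<theta> p1 p2 \<beta> =
    (1 - \<theta>) * measure_pmf.expectation (outcome_pmf p1 p2 \<beta>) (\<lambda>(w, d). G2 w d)"

definition banker_payoff ::
    "real \<Rightarrow> real \<Rightarrow> real \<Rightarrow> (nat \<times> nat \<times> nat \<Rightarrow> real) \<Rightarrow> real" where
  "banker_payoff \<theta> p1 p2 \<beta> =
    - measure_pmf.expectation (outcome_pmf p1 p2 \<beta>)
        (\<lambda>(w, d). \<theta> * G1 w d + (1 - \<theta>) * G2 w d)"

definition nash_equilibrium ::
    "real \<Rightarrow> real \<Rightarrow> real \<Rightarrow> (nat \<times> nat \<times> nat \<Rightarrow> real) \<Rightarrow> bool" where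
  "nash_equilibrium \<theta> p1 p2 \<beta> \<longleftrightarrow>
    p1 \<in> {0..1} \<and> p2 \<in> {0..1} \<and> \<beta> \<in> I \<rightarrow> {0..1} \<and>
    (\<forall>p\<in>{0..1}. payoff1 \<theta> p p2 \<beta> \<le> payoff1 \<theta> p1 p2 \<beta>) \<and>
    (\<forall>p\<in>{0..1}. payoff2 \<theta> p1 p \<beta> \<le> payoff2 \<theta> p1 p2 \<beta>) \<and>
    (\<forall>\<gamma>\<in>I \<rightarrow> {0..1}. banker_payoff \<theta> p1 p2 \<gamma> \<le> banker_payoff \<theta> p1 p2 \<beta>)"

text \<open>
  Banker's expected payoff given that the information set \<open>s\<close> is met and that he takes the
  action \<open>d\<close> there; only meaningful if \<open>s\<close> is met with positive probability.
\<close>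

definition banker_payoff_at ::
    "real \<Rightarrow> real \<Rightarrow> real \<Rightarrow> nat \<times> nat \<times> nat \<Rightarrow> bool \<Rightarrow> real" where
  "banker_payoff_at \<theta> p1 p2 s d =
    - measure_pmf.expectation
        (cond_pmf (play_pmf p1 p2) {w. banker_acts w \<and> info_set w = s})
        (\<lambda>w. \<theta> * G1 w d + (1 - \<theta>) * G2 w d)"

definition banker_indifferent ::
    "real \<Rightarrow> real \<Rightarrow> real \<Rightarrow> nat \<times> nat \<times> nat \<Rightarrow> bool" where
  "banker_indifferent \<theta> p1 p2 s \<longleftrightarrow>
    measure_pmf.prob (play_pmf p1 p2) {w. banker_acts w \<and> info_set w = s} > 0 \<and>
    banker_payoff_at \<theta> p1 p2 s True = banker_payoff_at \<theta> p1 p2 s False"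

end

theory Submission
  imports Defs
begin

text \<open>
  Why the equilibrium exists.  Banker's draw at the total \<open>j\<close> changes the outcome of a player
  only through that player's own hand, and the two hands are independent.  Hence the gain from drawing
  at \<open>(k1, k2, j)\<close> is, up to a positive factor, \<open>\<theta> g(k1, j) + (1 - \<theta>) g(k2, j)\<close> for one
  table \<open>g\<close> (\<open>gain\<close>), which depends on the common probability of drawing on 5.  The value
  9/11 of that probability is the one with \<open>g(10, 6) = 0\<close>; as \<open>g(11, j) = 0\<close> for every \<open>j\<close>,
  Banker is then indifferent at \<open>(10, 10, 6)\<close>, \<open>(10, 11, 6)\<close> and \<open>(11, 10, 6)\<close>.
  Elsewhere he draws exactly if the gain is positive (\<open>reply\<close>), which is a best reply whatever
  he does at these three sets (\<open>banker_best_reply\<close>).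

  A player's payoff is affine in his own probability, with a slope that is proportional to
  \<open>five_edge\<close>, the advantage of drawing on 5 over standing.  An equilibrium in which both
  players mix therefore needs both edges to vanish.  Standing at \<open>(10, 10, 6)\<close> uncouples the two equations: the
  edge of Player 1 still depends on the mixing probability at \<open>(10, 11, 6)\<close>, which has no
  influence on the edge of Player 2, and vice versa for \<open>(11, 10, 6)\<close>.  Each equation is linear with one unknown
  (\<open>mix\<close>), and exchanging the players turns \<open>\<theta>\<close> into \<open>1 - \<theta>\<close>, so it
  remains to prove \<open>0 \<le> mix t \<le> 1\<close> for all \<open>t\<close> between 5772/33847 and
  1 - 5772/33847 = 28075/33847 (\<open>mix_bounds\<close>).

  The number 5772/33847 is where the reply at \<open>(10, 0, 4)\<close> switches from standing to drawing;
  just below it \<open>mix\<close> is negative.  On the whole range the replies at dozens of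
  information sets switch, but there is enough slack to avoid following the switches one by one.  On an interval of
  values of \<open>t\<close> a gain whose signs at the endpoints agree has that sign throughout, and each of
  the remaining information sets is counted at its worst.  Three overlapping intervals suffice
  (\<open>edge_bound_le\<close>), and for each of them the bound is an integer computation.
\<close>

section \<open>Expectations over finitely supported distributions\<close>

abbreviation expect :: "'a pmf \<Rightarrow> ('a \<Rightarrow> real) \<Rightarrow> real" where
  "expect p f \<equiv> measure_pmf.expectation p f"

lemma expect_sum:
  assumes "finite A" "set_pmf p \<subseteq> A"
  shows "expect p f = (\<Sum>a\<in>A. pmf p a * f a)"
  using assms by (subst integral_measure_pmf[of A]) auto

lemma expect_cong: "(\<And>x. x \<in> set_pmf p \<Longrightarrow> f x = g x) \<Longrightarrow> expect p f = expect p g"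
  by (rule integral_cong_AE) (auto simp: AE_measure_pmf_iff)

lemma expect_bind:
  assumes "finite (set_pmf p)" "\<And>x. x \<in> set_pmf p \<Longrightarrow> finite (set_pmf (f x))"
  shows "expect (bind_pmf p f) h = expect p (\<lambda>x. expect (f x) h)"
  using assms by (simp add: pmf_expectation_bind[of "set_pmf p"] expect_sum[of "set_pmf p" p])

lemma expect_pair:
  assumes "finite (set_pmf p)" "finite (set_pmf q)"
  shows "expect (pair_pmf p q) f = expect p (\<lambda>x. expect q (\<lambda>y. f (x, y)))"
  using assms by (simp add: pair_pmf_def expect_bind)

lemma expect_commute:
  assumes "finite (set_pmf p)" "finite (set_pmf q)"
  shows "expect p (\<lambda>x. expect q (\<lambda>y. f x y)) = expect q (\<lambda>y. expect p (\<lambda>x. f x y))"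
  using assms
  by (simp add: expect_sum[of "set_pmf p" p] expect_sum[of "set_pmf q" q] sum_distrib_left
        mult.left_commute sum.swap[of _ "set_pmf p"])

lemma expect_add:
  assumes "finite (set_pmf p)"
  shows "expect p (\<lambda>x. f x + g x) = expect p f + expect p g"
  using assms by (simp add: expect_sum[of "set_pmf p" p] distrib_left sum.distrib)

lemma expect_diff:
  assumes "finite (set_pmf p)"
  shows "expect p (\<lambda>x. f x - g x) = expect p f - expect p g"
  using assms by (simp add: expect_sum[of "set_pmf p" p] right_diff_distrib sum_subtractf)

lemma expect_bernoulli:
  "expect (bernoulli_pmf p) f
    = f False + pmf (bernoulli_pmf p) True * (f True - f False)"
proof -
  have "pmf (bernoulli_pmf p) True + pmf (bernoulli_pmf p) False = 1"
    using sum_pmf_eq_1[of "{True, False}" "bernoulli_pmf p"] by auto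
  then have compl: "pmf (bernoulli_pmf p) False = 1 - pmf (bernoulli_pmf p) True"
    by simp
  have "expect (bernoulli_pmf p) f
      = pmf (bernoulli_pmf p) True * f True + pmf (bernoulli_pmf p) False * f False"
    by (subst expect_sum[of "{True, False}"]) auto
  then show ?thesis
    unfolding compl by (simp add: algebra_simps)
qed

lemma expect_cond_pmf:
  assumes "finite (set_pmf p)" "measure_pmf.prob p A > 0"
  shows "expect (cond_pmf p A) f = expect p (\<lambda>x. of_bool (x \<in> A) * f x) / measure_pmf.prob p A"
proof -
  have ne: "set_pmf p \<inter> A \<noteq> {}"
    using assms(2) by (metis less_irrefl measure_pmf_zero_iff)
  then have "set_pmf (cond_pmf p A) \<subseteq> set_pmf p"
    by (simp add: set_cond_pmf)
  then show ?thesis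
    using assms(1) ne
    by (simp add: expect_sum[of "set_pmf p"] pmf_cond sum_divide_distrib cong: if_cong)
       (auto intro: sum.cong)
qed

lemma set_two_card: "set_pmf two_card_pmf = {..9}"
  by (auto simp: set_pmf_iff pmf_two_card split: if_splits)

lemma set_third_card: "set_pmf third_card_pmf = {..9}"
  by (auto simp: set_pmf_iff pmf_third_card split: if_splits)

text \<open>
  A player's hand consists of his realised pure strategy, his two-card total and his third card, so
  that a play is a pair of independent hands together with the two cards of Banker.
\<close>

definition hand_pmf :: "real \<Rightarrow> (bool \<times> nat \<times> nat) pmf" where
  "hand_pmf p = pair_pmf (bernoulli_pmf p) (pair_pmf two_card_pmf third_card_pmf)"

lemma finite_hand: "finite (set_pmf (hand_pmf p))"
  by (simp add: hand_pmf_def set_two_card set_third_card)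

lemma expect_hand:
  "expect (hand_pmf p) f
    = expect (bernoulli_pmf p) (\<lambda>u. expect two_card_pmf (\<lambda>x. expect third_card_pmf (\<lambda>x'. f (u, x, x'))))"
  by (simp add: hand_pmf_def expect_pair set_two_card set_third_card)

lemma finite_play: "finite (set_pmf (play_pmf p1 p2))"
  by (simp add: play_pmf_def set_two_card set_third_card)

text \<open>
  Both sides are iterated expectations over the same eight independent variables, which occur in the
  same relative order within each of the three distributions.  Moving third cards outwards past two-card totals, and
  both past strategies, brings the two sides to the same normal form.
\<close>

lemma expect_play:
  "expect (play_pmf p1 p2) f =
    expect (hand_pmf p1) (\<lambda>(u1, x1, x1'). expect (hand_pmf p2) (\<lambda>(u2, x2, x2').
      expect two_card_pmf (\<lambda>y. expect third_card_pmf (\<lambda>y'.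
        f (u1, u2, x1, x2, y, x1', x2', y')))))"
proof -
  have swap:
    "\<And>p g. expect (bernoulli_pmf p) (\<lambda>u. expect two_card_pmf (\<lambda>x. g u x))
      = expect two_card_pmf (\<lambda>x. expect (bernoulli_pmf p) (\<lambda>u. g u x))"
    "\<And>p g. expect (bernoulli_pmf p) (\<lambda>u. expect third_card_pmf (\<lambda>x. g u x))
      = expect third_card_pmf (\<lambda>x. expect (bernoulli_pmf p) (\<lambda>u. g u x))"
    "\<And>p g. expect two_card_pmf (\<lambda>u. expect third_card_pmf (\<lambda>x. g u x))
      = expect third_card_pmf (\<lambda>x. expect two_card_pmf (\<lambda>u. g u x))"
    by (rule expect_commute; simp add: set_two_card set_third_card)+
  show ?thesis
    by (simp add: play_pmf_def expect_pair expect_hand set_two_card set_third_card)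
       (simp only: swap)
qed

section \<open>The effect of drawing on the expected outcome\<close>

text \<open>
  For a third card that is uniform on the ten values, the final total of Banker would be uniform and the mean outcome
  against \<open>f\<close> would be \<open>(f - (9 - f)) / 10\<close>.  The three additional zeros in the deck of 13
  leave the total at \<open>y\<close>.  Thus 13 times the mean outcome after a draw is
  \<open>2 f - 9 + 3 sgn (f - y)\<close>, to be compared with \<open>13 sgn (f - y)\<close> for standing.
\<close>

definition draw_swing :: "nat \<Rightarrow> nat \<Rightarrow> int" where
  "draw_swing f y = 2 * int f - 9 - 10 * sgn (int f - int y)"

lemma sgn_diff_int: "sgn_diff a b = of_int (sgn (int a - int b))"
  unfolding sgn_diff_def by (auto simp: sgn_if)

lemma expect_draw:
  assumes "f \<le> 9" "y \<le> 9"
  shows "expect third_card_pmf (\<lambda>y'. sgn_diff f (B True y y'))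
    = sgn_diff f y + draw_swing f y / 13"
proof -
  have 9: "{..9} = {0, 1, 2, 3, 4, 5, 6, 7, 8, 9 :: nat}"
    by auto
  have "f \<in> {0, 1, 2, 3, 4, 5, 6, 7, 8, 9}" "y \<in> {0, 1, 2, 3, 4, 5, 6, 7, 8, 9}"
    using assms by auto
  then show ?thesis
    by (auto simp: expect_sum[of "{..9}"] set_third_card 9 pmf_third_card B_def M_def
        sgn_diff_def draw_swing_def)
qed

text \<open>
  Outside \<open>[0, 1]\<close>, where \<^const>\<open>bernoulli_pmf\<close> truncates its parameter, this differs from
  \<open>\<beta> s\<close>.  A competing strategy of Banker is constrained on \<^const>\<open>I\<close> only,
  and working with the truncated value avoids every case distinction.
\<close>

definition draw_prob :: "(nat \<times> nat \<times> nat \<Rightarrow> real) \<Rightarrow> nat \<times> nat \<times> nat \<Rightarrow> real" where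
  "draw_prob \<beta> s = pmf (bernoulli_pmf (\<beta> s)) True"

lemma draw_prob_eq: "\<beta> s \<in> {0..1} \<Longrightarrow> draw_prob \<beta> s = \<beta> s"
  by (simp add: draw_prob_def)

lemma draw_prob_bounds: "draw_prob \<beta> s \<in> {0..1}"
  by (simp add: draw_prob_def pmf_le_1)

lemma expect_outcome:
  "expect (outcome_pmf p1 p2 \<beta>) (\<lambda>(w, d). f w d)
    = expect (play_pmf p1 p2)
        (\<lambda>w. f w False + draw_prob \<beta> (info_set w) * (f w True - f w False))"
  by (simp add: outcome_pmf_def expect_bind finite_play expect_bernoulli draw_prob_def)

fun stand_value :: "bool \<times> nat \<times> nat \<Rightarrow> bool \<times> nat \<times> nat \<Rightarrow> nat \<Rightarrow> real" where
  "stand_value (u1, x1, x1') (u2, x2, x2') y = G1 (u1, u2, x1, x2, y, x1', x2', 0) False"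

text \<open>
  A natural beats whatever Banker draws, which is the reason for the value 0.
\<close>

fun swing :: "bool \<times> nat \<times> nat \<Rightarrow> nat \<Rightarrow> real" where
  "swing (u, x, x') y = (if x \<ge> 8 then 0 else draw_swing (F u x x') y / 13)"

fun hand_K :: "bool \<times> nat \<times> nat \<Rightarrow> nat" where
  "hand_K (u, x, x') = K u x x'"

definition value1 :: "real \<Rightarrow> real \<Rightarrow> (nat \<times> nat \<times> nat \<Rightarrow> real) \<Rightarrow> real" where
  "value1 p1 p2 \<beta> = expect (outcome_pmf p1 p2 \<beta>) (\<lambda>(w, d). G1 w d)"

lemma F_le_9: "x \<le> 9 \<Longrightarrow> F u x x' \<le> 9"
  using mod_less_divisor[of 10 "x + x'"] by (auto simp: F_def M_def simp del: mod_less_divisor)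

text \<open>
  If both players have naturals, then \<open>swing\<close> is 0; therefore the only condition for the draw to matter
  that has to be mentioned is \<open>y \<le> 7\<close>.
\<close>

lemma value1_hands:
  "value1 p1 p2 \<beta> =
    expect (hand_pmf p1) (\<lambda>h1. expect (hand_pmf p2) (\<lambda>h2. expect two_card_pmf (\<lambda>y.
      stand_value h1 h2 y
      + of_bool (y \<le> 7) * draw_prob \<beta> (hand_K h1, hand_K h2, y) * swing h1 y)))"
proof -
  have inner: "expect third_card_pmf (\<lambda>y'.
       G1 (u1, u2, x1, x2, y, x1', x2', y') False
       + draw_prob \<beta> (K u1 x1 x1', K u2 x2 x2', y)
         * (G1 (u1, u2, x1, x2, y, x1', x2', y') True - G1 (u1, u2, x1, x2, y, x1', x2', y') False))
    = stand_value (u1, x1, x1') (u2, x2, x2') y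
      + of_bool (y \<le> 7) * draw_prob \<beta> (K u1 x1 x1', K u2 x2 x2', y) * swing (u1, x1, x1') y"
    if "x1 \<le> 9" "y \<le> 9" for u1 u2 x1 x2 y x1' x2'
  proof (cases "y \<ge> 8 \<or> x1 \<ge> 8")
    case True
    then show ?thesis by auto
  next
    case False
    then show ?thesis
      using expect_draw[OF F_le_9[OF that(1)] that(2)]
      by (simp add: expect_add expect_diff set_third_card B_def)
  qed
  show ?thesis
    unfolding value1_def expect_outcome expect_play
    by (auto simp: hand_pmf_def set_two_card inner split: prod.split
        intro!: expect_cong simp del: G1.simps stand_value.simps swing.simps)
qed

text \<open>
  The game is symmetric apart from the weights \<open>\<theta>\<close> and \<open>1 - \<theta>\<close>: exchanging the players
  amounts to exchanging the first two components of the information sets.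
\<close>

fun swap_players :: "nat \<times> nat \<times> nat \<Rightarrow> nat \<times> nat \<times> nat" where
  "swap_players (k1, k2, j) = (k2, k1, j)"

lemma value2_eq:
  "expect (outcome_pmf p1 p2 \<beta>) (\<lambda>(w, d). G2 w d) = value1 p2 p1 (\<beta> \<circ> swap_players)"
proof -
  have flip: "G2 (u1, u2, x1, x2, y, x1', x2', y') d = G1 (u2, u1, x2, x1, y, x2', x1', y') d"
    for u1 u2 x1 x2 y x1' x2' y' d
    by auto
  show ?thesis
    unfolding value1_def expect_outcome expect_play
    unfolding case_prod_unfold
    by (rule trans[OF expect_commute[OF finite_hand finite_hand]])
       (simp add: flip draw_prob_def del: G1.simps G2.simps)
qed

lemma payoff1_eq: "payoff1 \<theta> p1 p2 \<beta> = \<theta> * value1 p1 p2 \<beta>"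
  by (simp add: payoff1_def value1_def)

lemma payoff2_eq: "payoff2 \<theta> p1 p2 \<beta> = (1 - \<theta>) * value1 p2 p1 (\<beta> \<circ> swap_players)"
  by (simp add: payoff2_def value2_eq)

lemma finite_outcome: "finite (set_pmf (outcome_pmf p1 p2 \<beta>))"
  by (simp add: outcome_pmf_def finite_play)

lemma banker_payoff_eq:
  "banker_payoff \<theta> p1 p2 \<beta> = - (\<theta> * value1 p1 p2 \<beta> + (1 - \<theta>) * value1 p2 p1 (\<beta> \<circ> swap_players))"
proof -
  have "banker_payoff \<theta> p1 p2 \<beta>
    = - (\<theta> * expect (outcome_pmf p1 p2 \<beta>) (\<lambda>(w, d). G1 w d)
       + (1 - \<theta>) * expect (outcome_pmf p1 p2 \<beta>) (\<lambda>(w, d). G2 w d))"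
    by (simp add: banker_payoff_def case_prod_unfold expect_add[OF finite_outcome])
  then show ?thesis
    by (simp only: value2_eq value1_def)
qed

section \<open>Banker's best replies\<close>

lemma expect_sum_swap:
  assumes "finite (set_pmf p)"
  shows "expect p (\<lambda>x. \<Sum>a\<in>A. f a x) = (\<Sum>a\<in>A. expect p (f a))"
  using assms by (simp add: expect_sum[of "set_pmf p" p] sum_distrib_left sum.swap[of _ A])

definition K_weight :: "real \<Rightarrow> nat \<Rightarrow> real" where
  "K_weight p k = expect (hand_pmf p) (\<lambda>h. of_bool (hand_K h = k))"

definition swing_weight :: "real \<Rightarrow> nat \<Rightarrow> nat \<Rightarrow> real" where
  "swing_weight p k j = expect (hand_pmf p) (\<lambda>h. of_bool (hand_K h = k) * swing h j)"

lemma hand_K_le: "h \<in> set_pmf (hand_pmf p) \<Longrightarrow> hand_K h \<le> 11"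
  by (cases h) (auto simp: hand_pmf_def set_third_card K_def)

lemma expect_acting_totals:
  "expect two_card_pmf (\<lambda>y. of_bool (y \<le> 7) * g y) = (\<Sum>j\<le>7. pmf two_card_pmf j * g j)"
proof -
  have "expect two_card_pmf (\<lambda>y. of_bool (y \<le> 7) * g y)
      = (\<Sum>y\<le>9. pmf two_card_pmf y * (of_bool (y \<le> 7) * g y))"
    by (rule expect_sum) (auto simp: set_two_card)
  also have "\<dots> = (\<Sum>j\<le>7. pmf two_card_pmf j * g j)"
    by (rule sum.mono_neutral_cong_right) auto
  finally show ?thesis .
qed

lemma pick_term:
  fixes f :: "nat \<Rightarrow> real"
  shows "k \<le> n \<Longrightarrow> f k = (\<Sum>i\<le>n. of_bool (k = i) * f i)"
  by (simp add: of_bool_def if_distrib[of "\<lambda>x. x * _"] cong: if_cong)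

text \<open>
  The decisive separation: \<open>swing\<close> depends on the hand of Player 1 alone, and the other
  hand enters only through the probability of what Banker sees of it.  So in Player 1's value each information
  set carries the coefficient \<open>q(j)\<close> times a factor for \<open>k1\<close> times a factor for \<open>k2\<close>.
\<close>

lemma value1_split:
  "value1 p1 p2 \<beta> = value1 p1 p2 (\<lambda>_. 0)
    + (\<Sum>k1\<le>11. \<Sum>k2\<le>11. \<Sum>j\<le>7. draw_prob \<beta> (k1, k2, j)
        * (pmf two_card_pmf j * swing_weight p1 k1 j * K_weight p2 k2))"
proof -
  let ?c = "\<lambda>h1 h2 y. of_bool (y \<le> 7) * draw_prob \<beta> (hand_K h1, hand_K h2, y) * swing h1 y"
  let ?t = "\<lambda>k1 k2 j. draw_prob \<beta> (k1, k2, j) * pmf two_card_pmf j"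
  have split: "expect two_card_pmf (?c h1 h2)
      = (\<Sum>k1\<le>11. \<Sum>k2\<le>11. \<Sum>j\<le>7. ?t k1 k2 j * (of_bool (hand_K h1 = k1) * swing h1 j)
           * of_bool (hand_K h2 = k2))"
    if "h1 \<in> set_pmf (hand_pmf p1)" "h2 \<in> set_pmf (hand_pmf p2)" for h1 h2
  proof -
    have "expect two_card_pmf (?c h1 h2)
        = (\<Sum>j\<le>7. ?t (hand_K h1) (hand_K h2) j * swing h1 j)"
      using expect_acting_totals[of "\<lambda>y. draw_prob \<beta> (hand_K h1, hand_K h2, y) * swing h1 y"]
      by (simp only: mult_ac)
    also have "\<dots> = (\<Sum>k1\<le>11. of_bool (hand_K h1 = k1) *
        (\<Sum>j\<le>7. ?t k1 (hand_K h2) j * swing h1 j))"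
      by (rule pick_term[OF hand_K_le[OF that(1)],
            where f = "\<lambda>k1. \<Sum>j\<le>7. ?t k1 (hand_K h2) j * swing h1 j"])
    also have "\<dots> = (\<Sum>k1\<le>11. of_bool (hand_K h1 = k1) *
        (\<Sum>k2\<le>11. of_bool (hand_K h2 = k2) * (\<Sum>j\<le>7. ?t k1 k2 j * swing h1 j)))"
      by (rule sum.cong[OF refl], rule arg_cong[where f = "(*) (of_bool _)"],
          rule pick_term[OF hand_K_le[OF that(2)],
            where f = "\<lambda>k2. \<Sum>j\<le>7. ?t k1 k2 j * swing h1 j" for k1])
    finally show ?thesis
      by (simp only: sum_distrib_left mult_ac)
  qed
  have "expect (hand_pmf p1) (\<lambda>h1. expect (hand_pmf p2) (\<lambda>h2. expect two_card_pmf (?c h1 h2)))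
    = expect (hand_pmf p1) (\<lambda>h1. expect (hand_pmf p2) (\<lambda>h2.
        \<Sum>k1\<le>11. \<Sum>k2\<le>11. \<Sum>j\<le>7. ?t k1 k2 j * (of_bool (hand_K h1 = k1) * swing h1 j)
           * of_bool (hand_K h2 = k2)))"
    by (intro expect_cong split)
  also have "\<dots> = (\<Sum>k1\<le>11. \<Sum>k2\<le>11. \<Sum>j\<le>7. ?t k1 k2 j * swing_weight p1 k1 j * K_weight p2 k2)"
    by (simp only: expect_sum_swap[OF finite_hand] integral_mult_right_zero integral_mult_left_zero
        K_weight_def swing_weight_def)
  finally show ?thesis
    unfolding value1_hands
    by (simp add: expect_add finite_hand set_two_card mult.assoc draw_prob_def)
qed

definition banker_effect :: "real \<Rightarrow> real \<Rightarrow> real \<Rightarrow> nat \<times> nat \<times> nat \<Rightarrow> real" where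
  "banker_effect \<theta> p1 p2 = (\<lambda>(k1, k2, j). pmf two_card_pmf j *
     (\<theta> * swing_weight p1 k1 j * K_weight p2 k2 + (1 - \<theta>) * swing_weight p2 k2 j * K_weight p1 k1))"

lemma banker_payoff_split:
  "banker_payoff \<theta> p1 p2 \<beta> = banker_payoff \<theta> p1 p2 (\<lambda>_. 0)
    - (\<Sum>k1\<le>11. \<Sum>k2\<le>11. \<Sum>j\<le>7. draw_prob \<beta> (k1, k2, j) * banker_effect \<theta> p1 p2 (k1, k2, j))"
proof -
  let ?q = "pmf two_card_pmf"
  have "(\<Sum>k1\<le>11. \<Sum>k2\<le>11. \<Sum>j\<le>7. draw_prob (\<beta> \<circ> swap_players) (k1, k2, j)
        * (?q j * swing_weight p2 k1 j * K_weight p1 k2))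
      = (\<Sum>k1\<le>11. \<Sum>k2\<le>11. \<Sum>j\<le>7. draw_prob \<beta> (k1, k2, j)
        * (?q j * swing_weight p2 k2 j * K_weight p1 k1))"
    by (subst sum.swap) (simp add: draw_prob_def)
  moreover have "(\<lambda>_. 0) \<circ> swap_players = (\<lambda>_. 0 :: real)"
    by auto
  ultimately show ?thesis
    unfolding banker_payoff_eq value1_split[of _ _ \<beta>] value1_split[of _ _ "\<beta> \<circ> swap_players"] banker_effect_def
    by (simp add: algebra_simps sum.distrib sum_distrib_left sum_subtractf)
qed

text \<open>
  Banker's payoff is a sum over information sets with independent choices, hence it is maximised
  one information set at a time.  The sums also contain the sets \<open>(11, 11, j)\<close>, which are outside of
  \<^const>\<open>I\<close>; their coefficients are 0 because a natural has no swing.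
\<close>

lemma banker_best_reply:
  assumes pos: "\<And>k1 k2 j. k1 \<le> 11 \<Longrightarrow> k2 \<le> 11 \<Longrightarrow> j \<le> 7 \<Longrightarrow>
      banker_effect \<theta> p1 p2 (k1, k2, j) > 0 \<Longrightarrow> draw_prob \<beta> (k1, k2, j) = 0"
    and neg: "\<And>k1 k2 j. k1 \<le> 11 \<Longrightarrow> k2 \<le> 11 \<Longrightarrow> j \<le> 7 \<Longrightarrow>
      banker_effect \<theta> p1 p2 (k1, k2, j) < 0 \<Longrightarrow> draw_prob \<beta> (k1, k2, j) = 1"
  shows "banker_payoff \<theta> p1 p2 \<gamma> \<le> banker_payoff \<theta> p1 p2 \<beta>"
proof -
  have "draw_prob \<beta> (k1, k2, j) * banker_effect \<theta> p1 p2 (k1, k2, j)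
      \<le> draw_prob \<gamma> (k1, k2, j) * banker_effect \<theta> p1 p2 (k1, k2, j)"
    if "k1 \<le> 11" "k2 \<le> 11" "j \<le> 7" for k1 k2 j
    using pos[OF that] neg[OF that] draw_prob_bounds[of \<gamma> "(k1, k2, j)"]
    by (cases "banker_effect \<theta> p1 p2 (k1, k2, j)" "0 :: real" rule: linorder_cases)
       (auto simp: mult_le_cancel_right1)
  then show ?thesis
    unfolding banker_payoff_split[of _ _ _ \<beta>] banker_payoff_split[of _ _ _ \<gamma>]
    by (auto intro!: sum_mono)
qed

text \<open>
  The conditional payoffs for the two actions differ by the effect of the strategy that draws at the given
  information set only, divided by the probability of that set.
\<close>

lemma banker_indifferentI:
  assumes "k1 \<le> 11" "k2 \<le> 11" "j \<le> 7"
    and effect: "banker_effect \<theta> p1 p2 (k1, k2, j) = 0"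
    and prob: "measure_pmf.prob (play_pmf p1 p2) {w. banker_acts w \<and> info_set w = (k1, k2, j)} > 0"
  shows "banker_indifferent \<theta> p1 p2 (k1, k2, j)"
proof -
  let ?s = "(k1, k2, j)"
  let ?f = "\<lambda>w d. \<theta> * G1 w d + (1 - \<theta>) * G2 w d"
  \<comment> \<open>the strategy that draws at the given information set and nowhere else\<close>
  define \<beta> :: "nat \<times> nat \<times> nat \<Rightarrow> real" where "\<beta> = (\<lambda>s. of_bool (s = ?s))"
  have prob_\<beta>: "draw_prob \<beta> s = of_bool (s = ?s)" for s
    by (simp add: draw_prob_def \<beta>_def)
  have zero: "draw_prob \<beta> (l1, l2, i) * banker_effect \<theta> p1 p2 (l1, l2, i) = 0" for l1 l2 i
    using effect by (auto simp: prob_\<beta>)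
  have "banker_payoff \<theta> p1 p2 \<beta> = banker_payoff \<theta> p1 p2 (\<lambda>_. 0)"
    unfolding banker_payoff_split[of _ _ _ \<beta>] zero by simp
  then have "expect (play_pmf p1 p2) (\<lambda>w. of_bool (info_set w = ?s) * (?f w True - ?f w False)) = 0"
    unfolding banker_payoff_def expect_outcome prob_\<beta>
    by (simp add: draw_prob_def expect_add finite_play)
  moreover have "of_bool (info_set w = ?s) * (?f w True - ?f w False)
      = of_bool (w \<in> {w. banker_acts w \<and> info_set w = ?s}) * ?f w True
        - of_bool (w \<in> {w. banker_acts w \<and> info_set w = ?s}) * ?f w False" for w
    by (cases w) auto
  ultimately show ?thesis
    using prob unfolding banker_indifferent_def banker_payoff_at_def
    by (simp only: expect_cond_pmf[OF finite_play prob] expect_diff[OF finite_play]) simp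
qed

section \<open>A player's choice on a total of 5\<close>

text \<open>
  The index \<open>k\<close> is the player's third card if he draws, and \<open>l\<close> is what Banker sees of the other
  player.  There is no contribution from \<open>j \<ge> 8\<close>, because then no third card is dealt.
\<close>

definition five_edge :: "real \<Rightarrow> (nat \<times> nat \<times> nat \<Rightarrow> real) \<Rightarrow> real" where
  "five_edge p2 \<beta> = (\<Sum>j\<le>7. \<Sum>l\<le>11. pmf two_card_pmf j * K_weight p2 l *
     ((\<Sum>k\<le>9. pmf third_card_pmf k * (sgn_diff (M (5 + k)) j - sgn_diff 5 j
         + draw_prob \<beta> (k, l, j) * draw_swing (M (5 + k)) j / 13))
      - draw_prob \<beta> (10, l, j) * draw_swing 5 j / 13))"

text \<open>
  The two pure strategies act differently only if the two-card total is 5, which has probability 16/169.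
\<close>

lemma value1_affine:
  assumes "p \<in> {0..1}"
  shows "value1 p p2 \<beta> = value1 0 p2 \<beta> + p * (16 / 169 * five_edge p2 \<beta>)"
proof -
  define \<Phi> where "\<Phi> h1 = expect (hand_pmf p2) (\<lambda>h2. expect two_card_pmf (\<lambda>y.
      stand_value h1 h2 y
      + of_bool (y \<le> 7) * draw_prob \<beta> (hand_K h1, hand_K h2, y) * swing h1 y))" for h1
  define Z where "Z u = expect two_card_pmf (\<lambda>x. expect third_card_pmf (\<lambda>x'. \<Phi> (u, x, x')))" for u
  have val: "value1 p p2 \<beta> = Z False + p * (Z True - Z False)" if "p \<in> {0..1}" for p
    using that by (simp add: value1_hands \<Phi>_def[symmetric] expect_hand[of p] expect_bernoulli Z_def)
  have same: "\<Phi> (True, x, x') = \<Phi> (False, x, x')" if "x \<noteq> 5" for x x'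
  proof -
    have "K True x x' = K False x x'" "F True x x' = F False x x'"
      using that by (auto simp: K_def F_def player_draws_def)
    then show ?thesis
      unfolding \<Phi>_def by (intro expect_cong) (auto split: prod.split)
  qed
  let ?g = "\<lambda>x' l y. sgn_diff (M (5 + x')) y - sgn_diff 5 y
      + draw_prob \<beta> (x', l, y) * draw_swing (M (5 + x')) y / 13
      - draw_prob \<beta> (10, l, y) * draw_swing 5 y / 13"
  have five: "\<Phi> (True, 5, x') - \<Phi> (False, 5, x')
      = (\<Sum>j\<le>7. \<Sum>l\<le>11. pmf two_card_pmf j * K_weight p2 l * ?g x' l j)" for x'
  proof -
    have "\<Phi> (True, 5, x') - \<Phi> (False, 5, x')
        = expect (hand_pmf p2) (\<lambda>h2. expect two_card_pmf (\<lambda>y. of_bool (y \<le> 7) * ?g x' (hand_K h2) y))"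
      unfolding \<Phi>_def
      by (subst expect_diff[symmetric], simp add: finite_hand, intro expect_cong,
          subst expect_diff[symmetric], simp add: set_two_card, intro expect_cong)
         (auto simp: K_def F_def B_def player_draws_def split: prod.split)
    also have "\<dots> = expect (hand_pmf p2) (\<lambda>h2. \<Sum>j\<le>7. \<Sum>l\<le>11.
        pmf two_card_pmf j * ?g x' l j * of_bool (hand_K h2 = l))"
      unfolding expect_acting_totals
    proof (intro expect_cong sum.cong refl)
      fix h2 j assume "h2 \<in> set_pmf (hand_pmf p2)"
      then show "pmf two_card_pmf j * ?g x' (hand_K h2) j
          = (\<Sum>l\<le>11. pmf two_card_pmf j * ?g x' l j * of_bool (hand_K h2 = l))"
        using pick_term[OF hand_K_le, of h2 p2 "\<lambda>l. pmf two_card_pmf j * ?g x' l j"]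
        by (simp only: mult.commute)
    qed
    finally show ?thesis
      by (simp only: expect_sum_swap[OF finite_hand] integral_mult_right_zero K_weight_def[symmetric])
         (simp only: ac_simps)
  qed
  have third_1: "(\<Sum>k\<le>9. pmf third_card_pmf k) = 1"
    by (rule sum_pmf_eq_1) (auto simp: set_third_card)
  have "Z True - Z False = expect two_card_pmf (\<lambda>x. if x = 5
      then expect third_card_pmf (\<lambda>x'. \<Phi> (True, 5, x') - \<Phi> (False, 5, x')) else 0)"
    unfolding Z_def
    by (subst expect_diff[symmetric], simp add: set_two_card, rule expect_cong)
       (auto simp: set_third_card expect_diff same)
  also have "\<dots> = 16 / 169 * expect third_card_pmf (\<lambda>x'. \<Phi> (True, 5, x') - \<Phi> (False, 5, x'))"
    by (subst expect_sum[of "{..9}"]) (auto simp: set_two_card pmf_two_card if_distrib cong: if_cong)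
  also have "expect third_card_pmf (\<lambda>x'. \<Phi> (True, 5, x') - \<Phi> (False, 5, x')) = five_edge p2 \<beta>"
  proof -
    have avg: "(\<Sum>k\<le>9. pmf third_card_pmf k * (a k - c)) = (\<Sum>k\<le>9. pmf third_card_pmf k * a k) - c"
      for a c
      by (simp add: right_diff_distrib sum_subtractf sum_distrib_right[symmetric] third_1)
    show ?thesis
      unfolding five five_edge_def avg[symmetric]
      by (subst expect_sum_swap, simp add: set_third_card)+
         (simp add: set_third_card expect_sum[of "{..9}" third_card_pmf] mult.assoc sum_distrib_left)
  qed
  finally show ?thesis
    using val[OF assms] val[of 0] by simp
qed

section \<open>The table of gains at drawing probability 9/11\<close>

text \<open>
  The distribution of the two-card total on the event that the player draws, and, in the next definition, on
  the event that he stands, each multiplied by 11 times 169.  The total 5 occurs in both, with the weights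
  9/11 and 2/11.
\<close>

definition drawing_totals :: "(int \<times> nat) list" where
  "drawing_totals = [(275, 0), (176, 1), (176, 2), (176, 3), (176, 4), (144, 5)]"

definition standing_totals :: "(int \<times> nat) list" where
  "standing_totals = [(32, 5), (176, 6), (176, 7)]"

text \<open>
  The weights in the two lists above add up to 1123 and 384.  Multiplying each average by the total weight of the
  other list gives both kinds of rows the common denominator \<open>13 * 384 * 1123\<close> (see \<open>swing_weight_eq\<close>).
  The sign is opposite to that of \<open>draw_swing\<close> because Banker's gain is the player's loss.
\<close>

definition gain :: "nat \<Rightarrow> nat \<Rightarrow> int" where
  "gain k j = (if k \<le> 9 then - 384 * (\<Sum>(r, x)\<leftarrow>drawing_totals. r * draw_swing ((x + k) mod 10) j)
     else if k = 10 then - 1123 * (\<Sum>(r, x)\<leftarrow>standing_totals. r * draw_swing x j)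
     else 0)"

text \<open>
  24167 = 13 * 11 * 169 is the common denominator of the probabilities that Banker sees \<open>k\<close>.
\<close>

definition int_weight :: "nat \<Rightarrow> int" where
  "int_weight k = (if k = 0 then 4492 else if k \<le> 9 then 1123 else if k = 10 then 4992 else 4576)"

lemma expect_third_pick:
  "k \<le> 9 \<Longrightarrow> expect third_card_pmf (\<lambda>x'. of_bool (x' = k) * g x') = pmf third_card_pmf k * g k"
  by (subst expect_sum[of "{..9}"])
     (auto simp: set_third_card of_bool_def if_distrib[of "\<lambda>x. x * _"] if_distrib[of "\<lambda>x. _ * x"] cong: if_cong)

lemma expect_mix:
  "expect (bernoulli_pmf (9 / 11)) f = 2 / 11 * f False + 9 / 11 * f True"
  by (simp add: expect_bernoulli field_simps)

lemma expect_drawing_hand: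
  assumes "k \<le> 9"
  shows "expect (hand_pmf (9 / 11)) (\<lambda>h. of_bool (hand_K h = k) * g h)
    = pmf third_card_pmf k * (\<Sum>x\<le>9. pmf two_card_pmf x *
        (2 / 11 * (of_bool (x \<le> 4) * g (False, x, k)) + 9 / 11 * (of_bool (x \<le> 5) * g (True, x, k))))"
proof -
  have third: "expect third_card_pmf (\<lambda>x'. of_bool (hand_K (u, x, x') = k) * g (u, x, x'))
      = of_bool (x \<le> 4 + of_bool u) * (pmf third_card_pmf k * g (u, x, k))" for u x
    using expect_third_pick[OF assms, of "\<lambda>x'. g (u, x, x')"] assms
    by (auto simp: K_def player_draws_def)
  show ?thesis
    unfolding expect_hand third expect_mix
    by (simp add: expect_sum[of "{..9}" two_card_pmf] set_two_card
        sum_distrib_left sum.distrib[symmetric])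
       (auto intro!: sum.cong simp: algebra_simps)
qed

lemma expect_standing_hand:
  assumes "k > 9"
  shows "expect (hand_pmf (9 / 11)) (\<lambda>(u, x, x'). of_bool (K u x x' = k) * g x)
    = (\<Sum>x\<le>9. pmf two_card_pmf x * (of_bool (k = (if x \<le> 7 then 10 else 11))
        * (2 / 11 * of_bool (x \<ge> 5) + 9 / 11 * of_bool (x \<ge> 6)) * g x))"
proof -
  have third: "expect third_card_pmf (\<lambda>x'. of_bool (K u x x' = k) * g x)
      = of_bool (x \<ge> 5 + of_bool u) * (of_bool (k = (if x \<le> 7 then 10 else 11)) * g x)" for u x
  proof (cases "player_draws u x")
    case True
    have "expect third_card_pmf (\<lambda>x'. of_bool (x' = k) * g x) = expect third_card_pmf (\<lambda>_. 0)"
      using assms by (intro expect_cong) (auto simp: set_third_card)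
    with True show ?thesis
      by (auto simp: K_def player_draws_def)
  next
    case False
    then show ?thesis
      by (auto simp: K_def player_draws_def)
  qed
  show ?thesis
    unfolding expect_hand case_prod_conv third expect_mix
    by (simp add: expect_sum[of "{..9}" two_card_pmf] set_two_card
        sum_distrib_left sum.distrib[symmetric])
       (auto intro!: sum.cong simp: algebra_simps)
qed

lemma atMost_9: "{..9} = {0, 1, 2, 3, 4, 5, 6, 7, 8, 9 :: nat}"
  by auto

lemma K_weight_eq:
  assumes "k \<le> 11"
  shows "K_weight (9 / 11) k = int_weight k / 24167"
proof (cases "k \<le> 9")
  case True
  then show ?thesis
    using expect_drawing_hand[OF True, of "\<lambda>_. 1"]
    by (auto simp: K_weight_def int_weight_def pmf_third_card pmf_two_card atMost_9)
next
  case False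
  with assms have "k = 10 \<or> k = 11"
    by auto
  moreover have "(\<lambda>h. of_bool (hand_K h = k)) = (\<lambda>(u, x, x'). of_bool (K u x x' = k) * (1 :: real))"
    by auto
  ultimately show ?thesis
    using expect_standing_hand[of k "\<lambda>_. 1"]
    by (auto simp: K_weight_def int_weight_def pmf_two_card atMost_9)
qed

lemma swing_weight_eq:
  assumes "k \<le> 11" "j \<le> 7"
  shows "swing_weight (9 / 11) k j = - K_weight (9 / 11) k * gain k j / (13 * 384 * 1123)"
proof (cases "k \<le> 9")
  case True
  then show ?thesis
    using expect_drawing_hand[OF True, of "\<lambda>h. swing h j"]
    by (cases "k = 0")
       (simp_all add: swing_weight_def K_weight_eq int_weight_def pmf_third_card pmf_two_card atMost_9
        gain_def drawing_totals_def F_def M_def player_draws_def field_simps)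
next
  case False
  have "swing_weight (9 / 11) k j = expect (hand_pmf (9 / 11))
      (\<lambda>(u, x, x'). of_bool (K u x x' = k) * (if x \<ge> 8 then 0 else draw_swing x j / 13))"
    unfolding swing_weight_def using False
    by (intro expect_cong) (auto simp: K_def F_def hand_pmf_def set_third_card)
  moreover have "k = 10 \<or> k = 11"
    using False assms by auto
  ultimately show ?thesis
    using expect_standing_hand[of k "\<lambda>x. if x \<ge> 8 then 0 else draw_swing x j / 13"]
    by (auto simp: K_weight_eq int_weight_def pmf_two_card atMost_9
        gain_def standing_totals_def field_simps)
qed

section \<open>The edge as an integer combination of drawing probabilities\<close>

definition int_two_card :: "nat \<Rightarrow> int" where
  "int_two_card j = (if j = 0 then 25 else 16)"

text \<open>
  The case \<open>k = 10\<close> carries a negative sign since it describes the alternative of standing on 5.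
\<close>

definition edge_weight :: "nat \<Rightarrow> nat \<Rightarrow> int" where
  "edge_weight k j = (if k = 0 then 4 * draw_swing 5 j else if k \<le> 9 then draw_swing ((5 + k) mod 10) j
    else - 13 * draw_swing 5 j)"

definition edge_total :: "(nat \<times> nat \<times> nat \<Rightarrow> real) \<Rightarrow> real" where
  "edge_total d = (\<Sum>j\<le>7. \<Sum>l\<le>11. \<Sum>k\<le>10.
     real_of_int (int_two_card j * (int_weight l * edge_weight k j)) * d (k, l, j))"

text \<open>
  The constant is, up to the denominator, the edge against a Banker who never draws: the sum called \<open>base\<close> in the proof compares the
  player's totals with Banker's two-card totals and evaluates to -233.
\<close>

lemma five_edge_eq:
  "five_edge (9 / 11) \<beta> = (edge_total (draw_prob \<beta>) - 233 * 13 * 24167) / (169 * 24167 * 169)"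
proof -
  define base :: "nat \<Rightarrow> int" where "base j = (\<Sum>k\<le>9. (if k = 0 then 4 else 1)
      * (sgn (int ((5 + k) mod 10) - int j) - sgn (5 - int j)))" for j
  have ten: "{..10} = insert 10 {..9 :: nat}"
    by auto
  have inner: "(\<Sum>k\<le>9. pmf third_card_pmf k * (sgn_diff (M (5 + k)) j - sgn_diff 5 j
         + d k * draw_swing (M (5 + k)) j / 13)) - d 10 * draw_swing 5 j / 13
      = (13 * base j + (\<Sum>k\<le>10. edge_weight k j * d k)) / 169" for d :: "nat \<Rightarrow> real" and j
    by (simp add: ten atMost_9 base_def edge_weight_def pmf_third_card M_def sgn_diff_int field_simps)
  have weights: "(\<Sum>l\<le>11. int_weight l) = 24167"
    by (simp add: int_weight_def numeral_eq_Suc)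
  have bases: "(\<Sum>j\<le>7. int_two_card j * base j) = - 233"
  proof -
    have seven: "{..7} = {0, 1, 2, 3, 4, 5, 6, 7 :: nat}"
      by auto
    show ?thesis
      unfolding seven by (simp add: int_two_card_def base_def atMost_9)
  qed
  have "five_edge (9 / 11) \<beta> = (\<Sum>j\<le>7. \<Sum>l\<le>11. int_two_card j / 169 * (int_weight l / 24167)
      * ((13 * base j + (\<Sum>k\<le>10. edge_weight k j * draw_prob \<beta> (k, l, j))) / 169))"
    unfolding five_edge_def inner[where d = "\<lambda>k. draw_prob \<beta> (k, l, j)" and j = j for l j]
    by (intro sum.cong refl) (simp add: pmf_two_card int_two_card_def K_weight_eq)
  also have "\<dots> = (\<Sum>j\<le>7. \<Sum>l\<le>11. (int_two_card j * int_weight l * (13 * base j)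
      + (\<Sum>k\<le>10. int_two_card j * (int_weight l * edge_weight k j) * draw_prob \<beta> (k, l, j)))
        / (169 * 24167 * 169))"
  proof (intro sum.cong refl)
    fix j l :: nat
    have "(\<Sum>k\<le>10. real_of_int (int_two_card j * (int_weight l * edge_weight k j)) * draw_prob \<beta> (k, l, j))
        = int_two_card j * int_weight l * (\<Sum>k\<le>10. edge_weight k j * draw_prob \<beta> (k, l, j))"
      by (simp add: sum_distrib_left mult.assoc)
    then show "int_two_card j / 169 * (int_weight l / 24167)
        * ((13 * base j + (\<Sum>k\<le>10. edge_weight k j * draw_prob \<beta> (k, l, j))) / 169)
      = (int_two_card j * int_weight l * (13 * base j) + (\<Sum>k\<le>10. real_of_int (int_two_card j
          * (int_weight l * edge_weight k j)) * draw_prob \<beta> (k, l, j))) / (169 * 24167 * 169)"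
      by (simp add: distrib_left)
  qed
  also have "\<dots> = ((\<Sum>j\<le>7. \<Sum>l\<le>11. int_two_card j * int_weight l * (13 * base j))
      + edge_total (draw_prob \<beta>)) / (169 * 24167 * 169)"
    by (simp only: sum_divide_distrib[symmetric] sum.distrib edge_total_def of_int_sum)
  also have "(\<Sum>j\<le>7. \<Sum>l\<le>11. int_two_card j * int_weight l * (13 * base j))
      = (\<Sum>j\<le>7. 13 * (int_two_card j * base j)) * (\<Sum>l\<le>11. int_weight l)"
    unfolding sum_product by (intro sum.cong refl) (simp only: mult_ac)
  finally show ?thesis
    unfolding sum_distrib_left[symmetric] weights bases by simp
qed

section \<open>Bounding the edge on intervals of the parameter\<close>

definition reply :: "real \<Rightarrow> nat \<times> nat \<times> nat \<Rightarrow> real" where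
  "reply t = (\<lambda>(k1, k2, j). of_bool (t * gain k1 j + (1 - t) * gain k2 j > 0))"

text \<open>
  The worst case of a term that is either \<open>c\<close> or 0, depending on whether an affine function is positive
  on an open interval, given the values \<open>s1\<close> and \<open>s2\<close> of that function at the endpoints
  up to positive factors.
\<close>

definition pessimistic :: "int \<Rightarrow> int \<Rightarrow> int \<Rightarrow> int" where
  "pessimistic c s1 s2 = (if s1 \<le> 0 \<and> s2 \<le> 0 then 0 else if s1 \<ge> 0 \<and> s2 \<ge> 0 then c else min c 0)"

text \<open>
  The bound is a triple sum, written as a recursion over lists of triples so that the simplifier computes each
  gain at the endpoints once per row or column instead of once per information set.  An endpoint \<open>n / d\<close>
  is given as the pair \<open>(n, d)\<close>, and the gain there times \<open>d\<close> is the sum of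
  \<open>n * gain k j\<close> and \<open>(d - n) * gain l j\<close>.
\<close>

fun column_bound :: "int \<Rightarrow> int \<Rightarrow> int \<Rightarrow> (int \<times> int \<times> int) list \<Rightarrow> int" where
  "column_bound w h1 h2 [] = 0"
| "column_bound w h1 h2 ((c, g1, g2) # es) =
     pessimistic (w * c) (g1 + h1) (g2 + h2) + column_bound w h1 h2 es"

fun table_bound :: "(int \<times> int \<times> int) list \<Rightarrow> (int \<times> int \<times> int) list \<Rightarrow> int" where
  "table_bound [] es = 0"
| "table_bound ((w, h1, h2) # ws) es = column_bound w h1 h2 es + table_bound ws es"

text \<open>
  The sign \<open>\<sigma>\<close> is 1 for a lower bound and -1 for an upper bound of the edge.  This definition is kept
  separate from the sum over \<open>j\<close>, since the simplifier would otherwise unfold the recursion below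
  an abstraction, with \<open>j\<close> still a variable.
\<close>

definition total_bound :: "int \<Rightarrow> int \<times> int \<Rightarrow> int \<times> int \<Rightarrow> nat \<Rightarrow> int" where
  "total_bound \<sigma> a b j = int_two_card j * table_bound
     (map (\<lambda>l. (int_weight l, (snd a - fst a) * gain l j, (snd b - fst b) * gain l j)) [0..<Suc 11])
     (map (\<lambda>k. (\<sigma> * edge_weight k j, fst a * gain k j, fst b * gain k j)) [0..<Suc 10])"

definition edge_bound :: "int \<Rightarrow> int \<times> int \<Rightarrow> int \<times> int \<Rightarrow> int" where
  "edge_bound \<sigma> a b = sum_list (map (total_bound \<sigma> a b) [0..<Suc 7])"

text \<open>
  The value at \<open>t\<close> is a convex combination of the values at the endpoints with positive coefficients.  So it is
  positive as soon as both of these are nonnegative and one is positive; this covers the endpoint 5772/33847, at which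
  the gain for \<open>(10, 0, 4)\<close> is 0.
\<close>

lemma pessimistic_le:
  fixes t :: real and c g h n1 d1 n2 d2 :: int
  assumes "d1 > 0" "d2 > 0" and t: "n1 < d1 * t" "d2 * t < n2"
  shows "pessimistic c (n1 * g + (d1 - n1) * h) (n2 * g + (d2 - n2) * h)
    \<le> real_of_int c * of_bool (t * g + (1 - t) * h > 0)"
proof -
  define s1 s2 where "s1 = n1 * g + (d1 - n1) * h" and "s2 = n2 * g + (d2 - n2) * h"
  define w1 w2 where "w1 = n2 - d2 * t" and "w2 = d1 * t - n1"
  have w: "w1 > 0" "w2 > 0"
    using t by (auto simp: w1_def w2_def)
  have comb: "w1 * s1 + w2 * s2 = (d1 * n2 - d2 * n1) * (t * g + (1 - t) * h)"
    by (simp add: w1_def w2_def s1_def s2_def algebra_simps)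
  have "d1 * n2 - d2 * n1 = d1 * w1 + d2 * w2"
    by (simp add: w1_def w2_def algebra_simps)
  then have pos: "real_of_int (d1 * n2 - d2 * n1) > 0"
    using w assms by (simp add: add_pos_pos)
  have "\<not> t * g + (1 - t) * h > 0" if "s1 \<le> 0" "s2 \<le> 0"
  proof -
    have "w1 * s1 \<le> 0" "w2 * s2 \<le> 0"
      using w that by (auto intro!: mult_nonneg_nonpos)
    then show ?thesis
      using comb pos by (smt (verit) mult_pos_pos)
  qed
  moreover have "t * g + (1 - t) * h > 0" if "s1 \<ge> 0" "s2 \<ge> 0" "\<not> (s1 \<le> 0 \<and> s2 \<le> 0)"
  proof -
    have "w1 * s1 + w2 * s2 > 0"
    proof (cases "s1 > 0")
      case True
      then show ?thesis using w that by (intro add_pos_nonneg) auto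
    next
      case False
      then show ?thesis using w that by (intro add_nonneg_pos) auto
    qed
    then show ?thesis
      using comb pos by (simp add: zero_less_mult_iff)
  qed
  ultimately show ?thesis
    unfolding pessimistic_def s1_def[symmetric] s2_def[symmetric] by (auto simp: min_def)
qed

lemma column_bound_eq:
  "column_bound w h1 h2 es = (\<Sum>(c, g1, g2)\<leftarrow>es. pessimistic (w * c) (g1 + h1) (g2 + h2))"
  by (induction es) auto

lemma table_bound_eq:
  "table_bound ws es = (\<Sum>(w, h1, h2)\<leftarrow>ws. \<Sum>(c, g1, g2)\<leftarrow>es. pessimistic (w * c) (g1 + h1) (g2 + h2))"
  by (induction ws) (auto simp: column_bound_eq)

lemma sum_list_upt: "sum_list (map f [0..<Suc n]) = (\<Sum>i\<le>n. f i)" for f :: "nat \<Rightarrow> int"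
  by (simp only: interv_sum_list_conv_sum_set_nat set_upt atLeast0LessThan lessThan_Suc_atMost)

lemma edge_bound_le:
  fixes t :: real and n1 d1 n2 d2 :: int
  assumes "d1 > 0" "d2 > 0" "n1 < d1 * t" "d2 * t < n2"
  shows "edge_bound \<sigma> (n1, d1) (n2, d2) \<le> \<sigma> * edge_total (reply t)"
proof -
  have "real_of_int (edge_bound \<sigma> (n1, d1) (n2, d2))
    = real_of_int (\<Sum>j\<le>7. \<Sum>l\<le>11. \<Sum>k\<le>10. int_two_card j * pessimistic (int_weight l * (\<sigma> * edge_weight k j))
          (n1 * gain k j + (d1 - n1) * gain l j) (n2 * gain k j + (d2 - n2) * gain l j))"
    by (simp only: edge_bound_def total_bound_def table_bound_eq map_map comp_def case_prod_conv
        fst_conv snd_conv sum_list_upt sum_distrib_left)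
  also have "\<dots> \<le> (\<Sum>j\<le>7. \<Sum>l\<le>11. \<Sum>k\<le>10. int_two_card j
      * (real_of_int (int_weight l * (\<sigma> * edge_weight k j)) * reply t (k, l, j)))"
    unfolding of_int_sum
  proof (intro sum_mono)
    fix j l k :: nat
    have "real_of_int (pessimistic (int_weight l * (\<sigma> * edge_weight k j))
          (n1 * gain k j + (d1 - n1) * gain l j) (n2 * gain k j + (d2 - n2) * gain l j))
        \<le> real_of_int (int_weight l * (\<sigma> * edge_weight k j)) * reply t (k, l, j)"
      unfolding reply_def case_prod_conv by (rule pessimistic_le[OF assms])
    moreover have "int_two_card j \<ge> 0"
      by (simp add: int_two_card_def)
    ultimately show "real_of_int (int_two_card j * pessimistic (int_weight l * (\<sigma> * edge_weight k j))
          (n1 * gain k j + (d1 - n1) * gain l j) (n2 * gain k j + (d2 - n2) * gain l j))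
        \<le> real_of_int (int_two_card j)
          * (real_of_int (int_weight l * (\<sigma> * edge_weight k j)) * reply t (k, l, j))"
      unfolding of_int_mult[of "int_two_card j"] by (intro mult_left_mono) auto
  qed
  also have "\<dots> = \<sigma> * edge_total (reply t)"
    unfolding edge_total_def sum_distrib_left by (intro sum.cong refl) simp
  finally show ?thesis .
qed

text \<open>
  The weight of \<open>(10, 11, 6)\<close> in \<open>edge_total\<close> is \<open>- 16 * 4576 * 143\<close>, and \<open>reply\<close> stands
  there.  So this is the probability of drawing at \<open>(10, 11, 6)\<close> that makes the edge vanish.
\<close>

definition mix :: "real \<Rightarrow> real" where
  "mix t = (edge_total (reply t) - 233 * 13 * 24167) / (16 * 4576 * 143)"

lemma mix_bounds_on:
  fixes t :: real and n1 d1 n2 d2 :: int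
  assumes "edge_bound 1 (n1, d1) (n2, d2) \<ge> 233 * 13 * 24167"
    and "edge_bound (- 1) (n1, d1) (n2, d2) \<ge> - (233 * 13 * 24167 + 16 * 4576 * 143)"
    and "d1 > 0" "d2 > 0" "n1 < d1 * t" "d2 * t < n2"
  shows "mix t \<in> {0..1}"
proof -
  have "233 * 13 * 24167 \<le> edge_total (reply t)"
    using edge_bound_le[OF assms(3-6), of 1] assms(1) by linarith
  moreover have "edge_total (reply t) \<le> 233 * 13 * 24167 + 16 * 4576 * 143"
    using edge_bound_le[OF assms(3-6), of "- 1"] assms(2) by linarith
  ultimately show ?thesis
    by (simp add: mix_def)
qed

text \<open>
  The interior endpoints are round numbers; neighbouring intervals overlap because the bounds hold on open intervals only.
\<close>

lemma lower_interval:
  "edge_bound 1 (5772, 33847) (43, 100) \<ge> 233 * 13 * 24167"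
  "edge_bound (- 1) (5772, 33847) (43, 100) \<ge> - (233 * 13 * 24167 + 16 * 4576 * 143)"
  by code_simp+

lemma middle_interval:
  "edge_bound 1 (42, 100) (68, 100) \<ge> 233 * 13 * 24167"
  "edge_bound (- 1) (42, 100) (68, 100) \<ge> - (233 * 13 * 24167 + 16 * 4576 * 143)"
  by code_simp+

lemma upper_interval:
  "edge_bound 1 (67, 100) (28075, 33847) \<ge> 233 * 13 * 24167"
  "edge_bound (- 1) (67, 100) (28075, 33847) \<ge> - (233 * 13 * 24167 + 16 * 4576 * 143)"
  by code_simp+

lemma mix_bounds:
  assumes "t \<in> {5772 / 33847 <..< 28075 / 33847}"
  shows "mix t \<in> {0..1}"
proof -
  consider "t < 43 / 100" | "42 / 100 < t" "t < 68 / 100" | "67 / 100 < t"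
    by linarith
  then show ?thesis
  proof cases
    case 1
    with assms show ?thesis
      by (intro mix_bounds_on[OF lower_interval]) auto
  next
    case 2
    then show ?thesis
      by (intro mix_bounds_on[OF middle_interval]) auto
  next
    case 3
    with assms show ?thesis
      by (intro mix_bounds_on[OF upper_interval]) auto
  qed
qed

section \<open>The equilibrium\<close>

definition equilibrium :: "real \<Rightarrow> nat \<times> nat \<times> nat \<Rightarrow> real" where
  "equilibrium t = (reply t)((10, 11, 6) := mix t, (11, 10, 6) := mix (1 - t))"

lemma equilibrium_swap_players: "equilibrium t \<circ> swap_players = equilibrium (1 - t)"
  by (auto simp: equilibrium_def reply_def fun_eq_iff algebra_simps)

text \<open>
  The first equation characterises the probability \<open>p\<close> = 9/11 of drawing on 5: a player who stands has the totals
  5, 6, 7 in proportion \<open>1 - p : 1 : 1\<close>, and their swings against 6 are 11, 3, -5.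
\<close>

lemma gain_6: "gain 10 6 = 0" "gain 11 6 = 0"
  by code_simp+

lemma equilibrium_bounds:
  assumes "t \<in> {5772 / 33847 <..< 28075 / 33847}"
  shows "equilibrium t s \<in> {0..1}"
proof -
  have "1 - t \<in> {5772 / 33847 <..< 28075 / 33847}"
    using assms by auto
  then show ?thesis
    using mix_bounds[OF assms] mix_bounds[of "1 - t"]
    by (cases s) (auto simp: equilibrium_def reply_def)
qed

text \<open>
  Information sets with \<open>k1 = 11\<close> do not occur if Player 1 has a total of 5, so the mixing at \<open>(11, 10, 6)\<close> does
  not enter, and the mixing at \<open>(10, 11, 6)\<close> has been chosen to cancel the rest.
\<close>

lemma edge_total_equilibrium: "edge_total (equilibrium t) = 233 * 13 * 24167"
proof -
  have le: "6 \<le> (7 :: nat)" "11 \<le> (11 :: nat)" "10 \<le> (10 :: nat)"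
    by auto
  have "edge_total (equilibrium t)
      = edge_total (\<lambda>s. reply t s + of_bool (s = (10, 11, 6)) * mix t)"
    unfolding edge_total_def
    by (intro sum.cong refl) (auto simp: equilibrium_def reply_def gain_6)
  also have "\<dots> = edge_total (reply t) + (\<Sum>j\<le>7. \<Sum>l\<le>11. \<Sum>k\<le>10.
      of_bool (6 = j) * (of_bool (11 = l) * (of_bool (10 = k)
        * (int_two_card j * (int_weight l * edge_weight k j) * mix t))))"
    unfolding edge_total_def sum.distrib[symmetric]
    by (intro sum.cong refl) (auto simp: distrib_left)
  also have "\<dots> = edge_total (reply t) + int_two_card 6 * (int_weight 11 * edge_weight 10 6) * mix t"
    unfolding sum_distrib_left[symmetric] le[THEN pick_term, symmetric] of_int_mult ..
  also have "int_two_card 6 * (int_weight 11 * edge_weight 10 6) = - (16 * 4576 * 143)"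
    by (simp add: int_two_card_def int_weight_def edge_weight_def draw_swing_def)
  finally show ?thesis
    by (simp add: mix_def field_simps)
qed

lemma player_indifferent:
  assumes "t \<in> {5772 / 33847 <..< 28075 / 33847}" "p \<in> {0..1}"
  shows "value1 p (9 / 11) (equilibrium t) = value1 (9 / 11) (9 / 11) (equilibrium t)"
proof -
  have "draw_prob (equilibrium t) = equilibrium t"
    using equilibrium_bounds[OF assms(1)] by (intro ext draw_prob_eq)
  then show ?thesis
    using value1_affine[OF assms(2)] value1_affine[of "9 / 11"]
    by (simp add: five_edge_eq edge_total_equilibrium)
qed

lemma banker_effect_eq:
  assumes "k1 \<le> 11" "k2 \<le> 11" "j \<le> 7"
  obtains c where "c > 0"
    "banker_effect \<theta> (9 / 11) (9 / 11) (k1, k2, j) = - c * (\<theta> * gain k1 j + (1 - \<theta>) * gain k2 j)"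
proof
  let ?c = "pmf two_card_pmf j * K_weight (9 / 11) k1 * K_weight (9 / 11) k2 / (13 * 384 * 1123)"
  show "?c > 0"
    using assms by (simp add: K_weight_eq int_weight_def pmf_two_card)
  show "banker_effect \<theta> (9 / 11) (9 / 11) (k1, k2, j) = - ?c * (\<theta> * gain k1 j + (1 - \<theta>) * gain k2 j)"
    using assms by (simp add: banker_effect_def swing_weight_eq field_simps)
qed

theorem mainTheorem10:
  fixes \<theta> :: real
  assumes "\<theta> \<in> {5772 / 33847 <.. 1 / 2}"
  shows "\<exists>\<beta> :: nat \<times> nat \<times> nat \<Rightarrow> real.
    nash_equilibrium \<theta> (9 / 11) (9 / 11) \<beta> \<and>
    (\<forall>s \<in> I - {(10, 10, 6), (10, 11, 6), (11, 10, 6)}. \<beta> s \<in> {0, 1}) \<and>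
    (\<forall>s \<in> {(10, 10, 6), (10, 11, 6), (11, 10, 6)}. banker_indifferent \<theta> (9 / 11) (9 / 11) s)"
proof (intro exI conjI ballI)
  have in_range: "\<theta> \<in> {5772 / 33847 <..< 28075 / 33847}" "1 - \<theta> \<in> {5772 / 33847 <..< 28075 / 33847}"
    using assms by auto
  let ?\<beta> = "equilibrium \<theta>"
  have prob: "draw_prob ?\<beta> = ?\<beta>"
    using equilibrium_bounds[OF in_range(1)] by (intro ext draw_prob_eq)
  have banker: "banker_payoff \<theta> (9 / 11) (9 / 11) \<gamma> \<le> banker_payoff \<theta> (9 / 11) (9 / 11) ?\<beta>" for \<gamma>
  proof (rule banker_best_reply)
    fix k1 k2 j :: nat assume le: "k1 \<le> 11" "k2 \<le> 11" "j \<le> 7"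
    obtain c where c: "c > 0" "banker_effect \<theta> (9 / 11) (9 / 11) (k1, k2, j)
        = - c * (\<theta> * gain k1 j + (1 - \<theta>) * gain k2 j)"
      using banker_effect_eq[OF le] .
    show "draw_prob ?\<beta> (k1, k2, j) = 0" if "banker_effect \<theta> (9 / 11) (9 / 11) (k1, k2, j) > 0"
      using that c unfolding prob
      by (auto simp: equilibrium_def reply_def gain_6 mult_less_0_iff)
    show "draw_prob ?\<beta> (k1, k2, j) = 1" if "banker_effect \<theta> (9 / 11) (9 / 11) (k1, k2, j) < 0"
      using that c unfolding prob
      by (auto simp: equilibrium_def reply_def gain_6 zero_less_mult_iff)
  qed
  show "nash_equilibrium \<theta> (9 / 11) (9 / 11) ?\<beta>"
    unfolding nash_equilibrium_def payoff1_eq payoff2_eq equilibrium_swap_players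
  proof (intro conjI ballI)
    show "9 / 11 \<in> {0 .. 1 :: real}" "9 / 11 \<in> {0 .. 1 :: real}"
      by simp_all
    show "?\<beta> \<in> I \<rightarrow> {0..1}"
      using equilibrium_bounds[OF in_range(1)] by blast
    fix p :: real assume p: "p \<in> {0..1}"
    show "\<theta> * value1 p (9 / 11) ?\<beta> \<le> \<theta> * value1 (9 / 11) (9 / 11) ?\<beta>"
      by (simp only: player_indifferent[OF in_range(1) p] order_refl)
    show "(1 - \<theta>) * value1 p (9 / 11) (equilibrium (1 - \<theta>))
        \<le> (1 - \<theta>) * value1 (9 / 11) (9 / 11) (equilibrium (1 - \<theta>))"
      by (simp only: player_indifferent[OF in_range(2) p] order_refl)
  qed (rule banker)
  show "?\<beta> s \<in> {0, 1}" if "s \<in> I - {(10, 10, 6), (10, 11, 6), (11, 10, 6)}" for s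
    using that by (cases s) (auto simp: equilibrium_def reply_def)
  show "banker_indifferent \<theta> (9 / 11) (9 / 11) s" if "s \<in> {(10, 10, 6), (10, 11, 6), (11, 10, 6)}" for s
  proof -
    \<comment> \<open>Each of the three sets is met with totals 6 for standing and 8 for a natural.\<close>
    have met: "banker_indifferent \<theta> (9 / 11) (9 / 11) (k1, k2, 6)"
      if x: "x1 \<in> {6, 8}" "x2 \<in> {6, 8}" "x1 = 6 \<or> x2 = 6"
        and k: "k1 = (if x1 = 6 then 10 else 11)" "k2 = (if x2 = 6 then 10 else 11)"
      for x1 x2 k1 k2 :: nat
    proof (rule banker_indifferentI)
      show le: "k1 \<le> 11" "k2 \<le> 11" "6 \<le> (7 :: nat)"
        using k by auto
      show "banker_effect \<theta> (9 / 11) (9 / 11) (k1, k2, 6) = 0"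
        using k le by (auto simp: banker_effect_def swing_weight_eq gain_6)
      show "measure_pmf.prob (play_pmf (9 / 11) (9 / 11))
          {w. banker_acts w \<and> info_set w = (k1, k2, 6)} > 0"
        using x k
        by (intro measure_pmf_posI[of "(True, True, x1, x2, 6, 0, 0, 0)"])
           (auto simp: play_pmf_def set_two_card set_third_card set_pmf_bernoulli K_def player_draws_def)
    qed
    show ?thesis
      using that met[of 6 6] met[of 6 8] met[of 8 6] by auto
  qed
qed

end
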